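(* Let $\mathbb{K}\in\{\mathbb{R},\mathbb{C}\}$, let $L$ be a compact Hausdorff space, and let $\mathcal{A}\subseteq\mathcal{C}(L,\mathbb{K})$ be a self-adjoint algebra over $\mathbb{K}$ that vanishes nowhere on $L$ and such that the equivalence relation $\sim_{\mathcal{A}}$ is infinite. Then $\mathfrak{c}\leq\mathrm{codim}(\overline{\mathcal{A}})\leq 2^{\mathrm{ord}(\sim_{\mathcal{A}})}$. In particular, $\mathcal{C}(L,\mathbb{K})\setminus\overline{\mathcal{A}}$ is $\mathfrak{c}$-lineable but not $(2^{\mathrm{ord}(\sim_{\mathcal{A}})})^{+}$-lineable.
   Context: $\mathcal{C}(L,\mathbb{K})$ is the Banach space of continuous functions $L\to\mathbb{K}$ with the sup-norm, $\overline{\mathcal{A}}$ is the norm closure, and $\mathrm{codim}(\overline{\mathcal{A}})$ is the algebraic dimension over $\mathbb{K}$ of $\mathcal{C}(L,\mathbb{K})/\overline{\mathcal{A}}$. $\mathfrak{c}$ is the cardinality of the continuum and $\kappa^{+}$ is the least cardinal greater than $\kappa$. An algebra is a linear subspace closed under products (not necessarily containing constants). $\mathcal{A}$ is self-adjoint if $f\in\mathcal{A}$ implies $\overline{f}\in\mathcal{A}$; it vanishes nowhere on $L$ if for every $x\in L$ there is $f\in\mathcal{A}$ with $f(x)\neq 0$. The relation $\sim_{\mathcal{A}}$ on $L$ is defined by $x\sim_{\mathcal{A}}y$ iff $f(x)=f(y)$ for all $f\in\mathcal{A}$. For an equivalence relation $\rho$ on $L$, a set of representatives is a subset $R\subseteq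 L$ containing exactly one element of each equivalence class; the cardinal $\mathrm{ord}(\rho):=|L\setminus R|$ does not depend on the choice of $R$ and is called the order of $\rho$. The relation $\rho$ is infinite if $\mathrm{ord}(\rho)$ is infinite. A subset $M$ of a vector space $V$ is $\kappa$-lineable if $M\cup\{0\}$ contains a vector subspace of $V$ of (algebraic) dimension $\kappa$ over $\mathbb{K}$. *)

theory Defs
  imports
    "HOL-Analysis.Analysis"
    "HOL-Algebra.AbelCoset"
    "Jordan_Normal_Form.VS_Connect"
begin

unbundle cardinal_syntax

text \<open>For compact \<open>L\<close> every continuous function is bounded, so the library type \<open>'a \<Rightarrow>\<^sub>C 'k\<close> of bounded
  continuous functions with the sup-norm is \<open>C(L,K)\<close>, where \<open>L\<close> is the type \<open>'a\<close>. The library only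
  makes it a real vector space, whence the explicit scalar multiplication by \<open>'k\<close>.\<close>

lemma bounded_mult_range:
  fixes f g :: "'a \<Rightarrow> 'k::real_normed_field"
  assumes "bounded (range f)" "bounded (range g)"
  shows "bounded (range (\<lambda>x. f x * g x))"
proof -
  obtain a b where "\<And>x. norm (f x) \<le> a" "\<And>x. norm (g x) \<le> b"
    using assms by (auto simp: bounded_iff)
  then have "norm (f x * g x) \<le> a * b" for x
    unfolding norm_mult by (meson mult_mono norm_ge_zero order_trans)
  then show ?thesis by (auto simp: bounded_iff)
qed

context includes bcontfun.lifting
begin

lift_definition bcf_mult ::
    "('a::topological_space \<Rightarrow>\<^sub>C 'k::real_normed_field) \<Rightarrow> ('a \<Rightarrow>\<^sub>C 'k) \<Rightarrow> ('a \<Rightarrow>\<^sub>C 'k)"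
  is "\<lambda>f g x. f x * g x"
  by (auto simp: bcontfun_def intro!: continuous_intros bounded_mult_range)

lift_definition bcf_scale ::
    "'k \<Rightarrow> ('a::topological_space \<Rightarrow>\<^sub>C 'k::real_normed_field) \<Rightarrow> ('a \<Rightarrow>\<^sub>C 'k)"
  is "\<lambda>c f x. c * f x"
  by (auto simp: bcontfun_def intro!: continuous_intros bounded_mult_range)

end

definition cfun_algebra :: "('k, 'a::topological_space \<Rightarrow>\<^sub>C 'k::real_normed_field) module" where
  "cfun_algebra = \<lparr>carrier = UNIV, mult = bcf_mult, one = const_bcontfun 1,
     zero = 0, add = (+), smult = bcf_scale\<rparr>"

definition subalgebra :: "('a::topological_space \<Rightarrow>\<^sub>C 'k::real_normed_field) set \<Rightarrow> bool" where
  "subalgebra A \<longleftrightarrow>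
     VectorSpace.subspace class_ring A cfun_algebra \<and> (\<forall>f\<in>A. \<forall>g\<in>A. bcf_mult f g \<in> A)"

text \<open>The conjugation of the scalar field is a parameter: the identity on the reals, \<^const>\<open>cnj\<close> on the
  complex numbers.\<close>

definition self_adjoint ::
    "('k \<Rightarrow> 'k) \<Rightarrow> ('a::topological_space \<Rightarrow>\<^sub>C 'k::real_normed_field) set \<Rightarrow> bool" where
  "self_adjoint cj A \<longleftrightarrow> (\<forall>f\<in>A. \<exists>g\<in>A. \<forall>x. apply_bcontfun g x = cj (apply_bcontfun f x))"

definition vanishes_nowhere ::
    "('a::topological_space \<Rightarrow>\<^sub>C 'k::real_normed_field) set \<Rightarrow> bool" where
  "vanishes_nowhere A \<longleftrightarrow> (\<forall>x. \<exists>f\<in>A. apply_bcontfun f x \<noteq> 0)"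

definition sim ::
    "('a::topological_space \<Rightarrow>\<^sub>C 'k::real_normed_field) set \<Rightarrow> ('a \<times> 'a) set" where
  "sim A = {(x, y). \<forall>f\<in>A. apply_bcontfun f x = apply_bcontfun f y}"

definition set_of_representatives :: "('a \<times> 'a) set \<Rightarrow> 'a set \<Rightarrow> bool" where
  "set_of_representatives \<rho> R \<longleftrightarrow> (\<forall>C \<in> UNIV // \<rho>. \<exists>!x. x \<in> R \<inter> C)"

text \<open>For an equivalence relation this cardinal does not depend on the chosen representatives.\<close>

definition equiv_order :: "('a \<times> 'a) set \<Rightarrow> 'a rel" where
  "equiv_order \<rho> = |UNIV - (SOME R. set_of_representatives \<rho> R)|"

text \<open>The algebraic dimension as a cardinal: the cardinality of some Hamel basis
  (\<^const>\<open>vectorspace.dim\<close> is a natural number and only meaningful in finite dimension).\<close>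

definition vdim :: "('k, 'm) ring_scheme \<Rightarrow> ('k, 'v, 'n) module_scheme \<Rightarrow> 'v rel" where
  "vdim K V = |SOME B. vectorspace.basis K V B|"

text \<open>The quotient vector space \<open>V/W\<close> of cosets; the multiplicative fields of the record play no role.\<close>

definition quotient_space ::
    "('k, 'v, 'n) module_scheme \<Rightarrow> 'v set \<Rightarrow> ('k, 'v set) module" where
  "quotient_space V W = \<lparr>carrier = a_rcosets\<^bsub>V\<^esub> W, mult = undefined, one = undefined,
     zero = W, add = (\<lambda>C D. C <+>\<^bsub>V\<^esub> D),
     smult = (\<lambda>c C. \<Union>x\<in>C. W +>\<^bsub>V\<^esub> (c \<odot>\<^bsub>V\<^esub> x))\<rparr>"

definition codim ::
    "('k, 'm) ring_scheme \<Rightarrow> ('k, 'v, 'n) module_scheme \<Rightarrow> 'v set \<Rightarrow> 'v set rel" where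
  "codim K V W = vdim K (quotient_space V W)"

definition lineable ::
    "('k, 'm) ring_scheme \<Rightarrow> ('k, 'v, 'n) module_scheme \<Rightarrow> 'c rel \<Rightarrow> 'v set \<Rightarrow> bool" where
  "lineable K V \<kappa> M \<longleftrightarrow> (\<exists>S. VectorSpace.subspace K S V \<and> S \<subseteq> M \<union> {\<zero>\<^bsub>V\<^esub>} \<and>
     vdim K (V\<lparr>carrier := S\<rparr>) =o \<kappa>)"

abbreviation continuum :: "real rel" where
  "continuum \<equiv> |UNIV :: real set|"

end

theory Submission
  imports Defs "HOL-Library.Function_Algebras"
begin

text \<open>
  Write \<open>\<rho>\<close> for \<open>sim A\<close> and \<open>W\<close> for the closure of \<open>A\<close>. By Stone--Weierstrass, \<open>W\<close> consists of all
  continuous functions that are constant on the classes of \<open>\<rho>\<close>: such a function lives on the compact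
  Hausdorff space \<open>L/\<rho>\<close>, whose points \<open>A\<close> separates.

  Fix a set \<open>R\<close> of representatives, let \<open>r\<close> send each point to the representative of its class, and
  put \<open>N = L - R\<close>, the set of points that \<open>r\<close> moves. The linear map \<open>T f = (\<lambda>x. f x - f (r x))\<close> from
  \<open>C(L,K)\<close> to the space of all functions \<open>L \<rightarrow> K\<close> has kernel \<open>W\<close>. So it embeds \<open>C(L,K)/W\<close>, and also
  every subspace that meets \<open>W\<close> only in \<open>0\<close>, into the functions supported on \<open>N\<close>.

  For the upper bounds it is enough to count: the range of \<open>T\<close> has at most
  \<open>continuum ^c |N|\<close> elements, which equals \<open>ctwo ^c |N|\<close> because \<open>N\<close> is infinite.

  For the lower bounds take any sequence of distinct points \<open>a\<^sub>n\<close> of \<open>N\<close>. Since \<open>a\<^sub>m\<close> is never a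
  representative, Urysohn's lemma gives continuous \<open>f\<^sub>m : L \<rightarrow> [0,1]\<close> with value \<open>1\<close> at \<open>a\<^sub>m\<close> and \<open>0\<close> at
  the finitely many points \<open>r a\<^sub>m\<close>, \<open>a\<^sub>n\<close>, \<open>r a\<^sub>n\<close> with \<open>n < m\<close>; thus the matrix of the numbers
  \<open>T f\<^sub>m (a\<^sub>n)\<close> is triangular with diagonal \<open>1\<close>. Put \<open>g\<^sub>t = (\<Sum>m. t\<^sup>m f\<^sub>m)\<close> for \<open>0 < t < 1\<close>. If a linear
  combination of the functions \<open>T g\<^sub>t\<close> vanishes, the triangular shape forces every power sum
  \<open>\<Sum>t. c\<^sub>t t\<^sup>m\<close> to vanish, and then all coefficients are \<open>0\<close>, by Vandermonde. Hence the \<open>g\<^sub>t\<close> are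
  continuum many vectors that are independent modulo \<open>W\<close>.

  The dimension of a record vector space is the cardinality of an arbitrarily chosen basis. The locale
  \<open>linear_embedding\<close> moves bases along an injective linear map, so that bases need only be
  studied in vector spaces that fill a whole type, where any two infinite bases are equipotent.
\<close>

section \<open>Cardinalities of infinite bases\<close>

context vector_space
begin

text \<open>Every element of \<open>B\<close> is a combination of finitely many elements of \<open>J\<close>. The elements of \<open>J\<close> used in
  this way already span \<open>J\<close>, so by independence they are all of \<open>J\<close>; hence \<open>J\<close> is a union of \<open>|B|\<close>
  finite sets. Applied in both directions this shows that infinite bases are equipotent.\<close>

lemma card_of_independent_le_spanning:
  assumes indep: "independent J" and JB: "J \<subseteq> span B" and BJ: "B \<subseteq> span J" and inf: "infinite J"
  shows "|J| \<le>o |B|"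
proof -
  have "\<exists>F. finite F \<and> F \<subseteq> J \<and> b \<in> span F" if "b \<in> B" for b
  proof -
    from that BJ have "b \<in> span J" by blast
    then obtain t r where "finite t" "t \<subseteq> J" "b = (\<Sum>a\<in>t. scale (r a) a)"
      unfolding span_explicit by blast
    then show ?thesis
      by (meson span_base span_scale span_sum)
  qed
  then obtain F where F: "\<And>b. b \<in> B \<Longrightarrow> finite (F b) \<and> F b \<subseteq> J \<and> b \<in> span (F b)"
    by metis
  define J0 where "J0 = (\<Union>b\<in>B. F b)"
  have J0: "J0 \<subseteq> J" using F by (auto simp: J0_def)
  have "B \<subseteq> span J0"
    using F span_mono[of "F _" J0] by (fastforce simp: J0_def)
  then have J_span: "J \<subseteq> span J0"
    using JB by (metis order_trans span_mono span_span)
  have "J = J0"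
  proof (rule ccontr)
    assume "J \<noteq> J0"
    then obtain x where x: "x \<in> J" "J0 \<subseteq> J - {x}" using J0 by blast
    then have "x \<in> span (J - {x})" using J_span span_mono by blast
    then show False using indep x(1) unfolding dependent_def by blast
  qed
  have "infinite B"
    using inf F unfolding \<open>J = J0\<close> J0_def by blast
  \<comment> \<open>Finite sets of any size are absorbed because \<open>B\<close> is infinite.\<close>
  have "|F b| \<le>o |B|" if "b \<in> B" for b
    using F[OF that] \<open>infinite B\<close>
    by (meson finite_iff_ordLess_natLeq infinite_iff_natLeq_ordLeq ordLess_imp_ordLeq ordLess_ordLeq_trans)
  then show ?thesis
    unfolding \<open>J = J0\<close> J0_def
    by (intro card_of_UNION_ordLeq_infinite[OF \<open>infinite B\<close> ordLeq_refl[OF card_of_Card_order]]) auto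
qed

end

section \<open>Transport of bases along an injective linear map\<close>

text \<open>\<open>V\<close> is a vector space because the injective map \<open>\<phi>\<close> pulls the axioms back from the ambient space.
  For a quotient this replaces computations with cosets by computations with the images of
  representatives.\<close>

locale linear_embedding = U: vector_space scale
  for scale :: "'k::field \<Rightarrow> 'u::ab_group_add \<Rightarrow> 'u" +
  fixes V :: "('k, 'v, 'n) module_scheme" and \<phi> :: "'v \<Rightarrow> 'u"
  assumes inj: "inj_on \<phi> (carrier V)"
    and zero_closed: "\<zero>\<^bsub>V\<^esub> \<in> carrier V"
    and add_closed: "\<lbrakk>v \<in> carrier V; w \<in> carrier V\<rbrakk> \<Longrightarrow> v \<oplus>\<^bsub>V\<^esub> w \<in> carrier V"
    and smult_closed: "v \<in> carrier V \<Longrightarrow> c \<odot>\<^bsub>V\<^esub> v \<in> carrier V"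
    and hom_zero: "\<phi> \<zero>\<^bsub>V\<^esub> = 0"
    and hom_add: "\<lbrakk>v \<in> carrier V; w \<in> carrier V\<rbrakk> \<Longrightarrow> \<phi> (v \<oplus>\<^bsub>V\<^esub> w) = \<phi> v + \<phi> w"
    and hom_smult: "v \<in> carrier V \<Longrightarrow> \<phi> (c \<odot>\<^bsub>V\<^esub> v) = scale c (\<phi> v)"
begin

lemma vectorspace: "vectorspace class_ring V"
proof (rule vs_criteria)
  show "field (class_ring :: 'k ring)" by (rule class_field.field_axioms)
  show "\<forall>v\<in>carrier V. \<exists>w\<in>carrier V. v \<oplus>\<^bsub>V\<^esub> w = \<zero>\<^bsub>V\<^esub>"
  proof
    fix v assume v: "v \<in> carrier V"
    have "\<phi> (v \<oplus>\<^bsub>V\<^esub> ((-1) \<odot>\<^bsub>V\<^esub> v)) = \<phi> \<zero>\<^bsub>V\<^esub>"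
      using v by (simp add: hom_add hom_smult smult_closed hom_zero)
    then have "v \<oplus>\<^bsub>V\<^esub> ((-1) \<odot>\<^bsub>V\<^esub> v) = \<zero>\<^bsub>V\<^esub>"
      using v by (meson inj inj_onD add_closed smult_closed zero_closed)
    then show "\<exists>w\<in>carrier V. v \<oplus>\<^bsub>V\<^esub> w = \<zero>\<^bsub>V\<^esub>"
      using smult_closed[OF v] by blast
  qed
qed (auto intro!: inj_onD[OF inj] simp: zero_closed add_closed smult_closed hom_zero hom_add
      hom_smult U.scale_left_distrib U.scale_right_distrib add_ac)

interpretation vectorspace class_ring V by (rule vectorspace)

lemma hom_lincomb:
  assumes "finite A" "A \<subseteq> carrier V"
  shows "lincomb a A \<in> carrier V \<and> \<phi> (lincomb a A) = (\<Sum>v\<in>A. scale (a v) (\<phi> v))"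
  using assms
proof (induction A rule: finite_induct)
  case empty
  then show ?case by (simp add: lincomb_def zero_closed hom_zero)
next
  case (insert x F)
  have "lincomb a (insert x F) = (a x \<odot>\<^bsub>V\<^esub> x) \<oplus>\<^bsub>V\<^esub> lincomb a F"
    unfolding lincomb_def using insert.hyps insert.prems
    by (intro finsum_insert) (auto simp: smult_closed)
  then show ?case using insert by (simp add: add_closed smult_closed hom_add hom_smult)
qed

lemma lin_dep_iff:
  assumes B: "B \<subseteq> carrier V"
  shows "lin_dep B \<longleftrightarrow> U.dependent (\<phi> ` B)"
proof
  assume "lin_dep B"
  then obtain A a v where A: "finite A" "A \<subseteq> B" "lincomb a A = \<zero>\<^bsub>V\<^esub>" "v \<in> A" "a v \<noteq> 0"
    unfolding lin_dep_def by auto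
  have injA: "inj_on \<phi> A" using A B inj inj_on_subset by (metis subset_trans)
  have "(\<Sum>y\<in>\<phi> ` A. scale (a (inv_into A \<phi> y)) y) = (\<Sum>v\<in>A. scale (a v) (\<phi> v))"
    by (simp add: sum.reindex[OF injA] injA)
  also have "\<dots> = 0" using hom_lincomb[of A a] A B by (simp add: hom_zero)
  finally show "U.dependent (\<phi> ` B)"
    unfolding U.dependent_explicit using A injA
    by (intro exI[of _ "\<phi> ` A"] exI[of _ "\<lambda>y. a (inv_into A \<phi> y)"]) (auto intro!: bexI[of _ v])
next
  assume "U.dependent (\<phi> ` B)"
  then obtain S u y where S: "finite S" "S \<subseteq> \<phi> ` B" "y \<in> S" "u y \<noteq> 0" "(\<Sum>v\<in>S. scale (u v) v) = 0"
    unfolding U.dependent_explicit by blast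
  obtain A where A: "A \<subseteq> B" "inj_on \<phi> A" "S = \<phi> ` A"
    using S(2) by (metis subset_image_inj)
  have fin: "finite A" using S(1) A finite_imageD by blast
  have "\<phi> (lincomb (u \<circ> \<phi>) A) = 0"
    using S(5) hom_lincomb[of A "u \<circ> \<phi>"] A B fin by (simp add: sum.reindex)
  then have "lincomb (u \<circ> \<phi>) A = \<zero>\<^bsub>V\<^esub>"
    using hom_lincomb[of A "u \<circ> \<phi>"] A B fin
    by (intro inj_onD[OF inj]) (auto simp: hom_zero zero_closed)
  moreover obtain v where "v \<in> A" "y = \<phi> v" using S A by blast
  ultimately show "lin_dep B"
    unfolding lin_dep_def using fin A S(4)
    by (intro exI[of _ A] exI[of _ "u \<circ> \<phi>"] exI[of _ v]) auto
qed

lemma image_span: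
  assumes B: "B \<subseteq> carrier V"
  shows "\<phi> ` span B = U.span (\<phi> ` B)"
proof
  show "\<phi> ` span B \<subseteq> U.span (\<phi> ` B)"
  proof
    fix y assume "y \<in> \<phi> ` span B"
    then obtain a A where A: "finite A" "A \<subseteq> B" "y = \<phi> (lincomb a A)"
      unfolding span_def by blast
    then have "y = (\<Sum>v\<in>A. scale (a v) (\<phi> v))" using hom_lincomb[of A a] B by auto
    then show "y \<in> U.span (\<phi> ` B)"
      using A(2) by (simp, intro U.span_sum U.span_scale U.span_base) blast
  qed
next
  show "U.span (\<phi> ` B) \<subseteq> \<phi> ` span B"
  proof
    fix y assume "y \<in> U.span (\<phi> ` B)"
    then obtain S u where S: "finite S" "S \<subseteq> \<phi> ` B" "y = (\<Sum>v\<in>S. scale (u v) v)"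
      unfolding U.span_explicit by blast
    obtain A where A: "A \<subseteq> B" "inj_on \<phi> A" "S = \<phi> ` A"
      using S(2) by (metis subset_image_inj)
    have fin: "finite A" using S(1) A finite_imageD by blast
    have "y = \<phi> (lincomb (u \<circ> \<phi>) A)"
      using S(3) hom_lincomb[of A "u \<circ> \<phi>"] A B fin by (simp add: sum.reindex)
    then show "y \<in> \<phi> ` span B" using A fin unfolding span_def by auto
  qed
qed

lemma basis_iff:
  assumes B: "B \<subseteq> carrier V"
  shows "basis B \<longleftrightarrow> U.independent (\<phi> ` B) \<and> U.span (\<phi> ` B) = \<phi> ` carrier V"
proof -
  have "span B = carrier V \<longleftrightarrow> \<phi> ` span B = \<phi> ` carrier V"
    using inj span_is_subset2[OF B] by (auto simp: inj_on_image_eq_iff)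
  then show ?thesis
    using B by (simp add: basis_def lin_dep_iff image_span)
qed

text \<open>The choice operator in \<^const>\<open>vdim\<close> says something only if a basis exists; one is pulled back from
  a maximal independent subset of the image.\<close>

lemma vdim_eq_card_of_basis:
  obtains B where "U.independent B" "U.span B = \<phi> ` carrier V" "vdim class_ring V =o |B|"
proof -
  obtain B' where B': "B' \<subseteq> \<phi> ` carrier V" "U.independent B'" "\<phi> ` carrier V \<subseteq> U.span B'"
    using U.maximal_independent_subset by blast
  then obtain B where B: "B \<subseteq> carrier V" "B' = \<phi> ` B" by (meson subset_imageE)
  have "U.span B' \<subseteq> \<phi> ` carrier V"
    using image_span[OF B(1)] span_is_subset2[OF B(1)] B(2) by blast
  then have "basis B" using B B' by (simp add: basis_iff)
  then have some: "basis (SOME B. basis B)" by (rule someI)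
  let ?B = "SOME B. basis B"
  have sub: "?B \<subseteq> carrier V" using some unfolding basis_def by blast
  have "|\<phi> ` ?B| =o |?B|"
    using sub inj by (meson card_of_ordIsoI inj_on_subset inj_on_imp_bij_betw ordIso_symmetric)
  then show thesis
    using that[of "\<phi> ` ?B"] some basis_iff[OF sub] ordIso_symmetric unfolding vdim_def by blast
qed

text \<open>\<open>I\<close> is compared with the chosen basis through a basis that extends \<open>I\<close>.\<close>

lemma card_of_independent_le_vdim:
  assumes I: "U.independent I" "I \<subseteq> \<phi> ` carrier V" and inf: "infinite I"
  shows "|I| \<le>o vdim class_ring V"
proof -
  obtain B where B: "U.independent B" "U.span B = \<phi> ` carrier V" "vdim class_ring V =o |B|"
    by (rule vdim_eq_card_of_basis)
  obtain J where J: "I \<subseteq> J" "J \<subseteq> U.span B" "U.independent J" "U.span B \<subseteq> U.span J"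
    using U.maximal_independent_subset_extend[of I "U.span B"] I B(2) by metis
  have "|J| \<le>o |B|"
    using J infinite_super[OF J(1) inf] U.span_superset[of B]
    by (intro U.card_of_independent_le_spanning) auto
  then have "|I| \<le>o |B|" using J(1) card_of_mono1 ordLeq_transitive by blast
  then show ?thesis using B(3) ordIso_symmetric ordLeq_ordIso_trans by blast
qed

lemma vdim_eq_card_of_independent_spanning:
  assumes I: "U.independent I" "U.span I = \<phi> ` carrier V" and inf: "infinite I"
  shows "vdim class_ring V =o |I|"
proof -
  obtain B where B: "U.independent B" "U.span B = \<phi> ` carrier V" "vdim class_ring V =o |B|"
    by (rule vdim_eq_card_of_basis)
  have IB: "|I| \<le>o |B|"
    using I B inf U.span_superset[of I] U.span_superset[of B] by (intro U.card_of_independent_le_spanning) auto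
  then have "infinite B" using inf card_of_ordLeq_finite by blast
  then have "|B| \<le>o |I|"
    using I B U.span_superset[of I] U.span_superset[of B] by (intro U.card_of_independent_le_spanning) auto
  then show ?thesis using IB B(3) ordIso_iff_ordLeq ordIso_transitive by blast
qed

lemma vdim_le_card_of_carrier: "vdim class_ring V \<le>o |\<phi> ` carrier V|"
proof -
  obtain B where B: "U.span B = \<phi> ` carrier V" "vdim class_ring V =o |B|"
    by (rule vdim_eq_card_of_basis)
  have "|B| \<le>o |\<phi> ` carrier V|" using U.span_superset[of B] B(1) card_of_mono1 by metis
  then show ?thesis using B(2) ordIso_ordLeq_trans by blast
qed

end

section \<open>Stone--Weierstrass for functions constant on classes\<close>

text \<open>The quotient \<open>L/\<rho>\<close> will be realized as a compact subset of a product of real lines, to which the type-class version of Stone--Weierstrass applies. The weaker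
  separation axioms come first because each class needs the arity of its superclass.\<close>

instance "fun" :: (type, t0_space) t0_space
proof
  fix f g :: "'a \<Rightarrow> 'b" assume "f \<noteq> g"
  then obtain x where "f x \<noteq> g x" by blast
  then obtain U where U: "open U" "f x \<in> U \<longleftrightarrow> g x \<notin> U" using separation_t0[of "f x" "g x"] by blast
  have "open ((\<lambda>h::'a\<Rightarrow>'b. h x) -` U)"
    using U by (auto intro!: open_vimage continuous_on_product_coordinates)
  then show "\<exists>U. open U \<and> \<not> (f \<in> U \<longleftrightarrow> g \<in> U)"
    using U by (intro exI[of _ "(\<lambda>h. h x) -` U"]) auto
qed

instance "fun" :: (type, t1_space) t1_space
proof
  fix f g :: "'a \<Rightarrow> 'b" assume "f \<noteq> g"
  then obtain x where "f x \<noteq> g x" by blast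
  then obtain U where U: "open U" "f x \<in> U" "g x \<notin> U" using t1_space by metis
  have "open ((\<lambda>h::'a\<Rightarrow>'b. h x) -` U)"
    using U by (auto intro!: open_vimage continuous_on_product_coordinates)
  then show "\<exists>U. open U \<and> f \<in> U \<and> g \<notin> U"
    using U by (intro exI[of _ "(\<lambda>h. h x) -` U"]) auto
qed

instance "fun" :: (type, t2_space) t2_space
proof
  fix f g :: "'a \<Rightarrow> 'b" assume "f \<noteq> g"
  then obtain x where "f x \<noteq> g x" by blast
  then obtain U V where UV: "open U" "open V" "f x \<in> U" "g x \<in> V" "U \<inter> V = {}"
    using hausdorff[of "f x" "g x"] by blast
  have "open ((\<lambda>h::'a\<Rightarrow>'b. h x) -` U)" "open ((\<lambda>h::'a\<Rightarrow>'b. h x) -` V)"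
    using UV by (auto intro!: open_vimage continuous_on_product_coordinates)
  then show "\<exists>U V. open U \<and> open V \<and> f \<in> U \<and> g \<in> V \<and> U \<inter> V = {}"
    using UV by (intro exI[of _ "(\<lambda>h. h x) -` U"] exI[of _ "(\<lambda>h. h x) -` V"]) auto
qed

lemma subalgebraD:
  assumes "subalgebra A"
  shows "0 \<in> A"
    and "\<And>f g. f \<in> A \<Longrightarrow> g \<in> A \<Longrightarrow> f + g \<in> A"
    and "\<And>c f. f \<in> A \<Longrightarrow> bcf_scale c f \<in> A"
    and "\<And>f g. f \<in> A \<Longrightarrow> g \<in> A \<Longrightarrow> bcf_mult f g \<in> A"
proof -
  have "submodule class_ring A cfun_algebra"
    using assms unfolding subalgebra_def VectorSpace.subspace_def by blast
  note * = submodule.zero_closed[OF this] submodule.m_closed[OF this] submodule.smult_closed[OF this]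
  show "0 \<in> A" using *(1) by (simp add: cfun_algebra_def)
  show "f + g \<in> A" if "f \<in> A" "g \<in> A" for f g
    using *(2)[OF that] by (simp add: cfun_algebra_def)
  show "bcf_scale c f \<in> A" if "f \<in> A" for c f
    using *(3)[OF _ that, of c] by (simp add: cfun_algebra_def)
  show "bcf_mult f g \<in> A" if "f \<in> A" "g \<in> A" for f g
    using assms that unfolding subalgebra_def by blast
qed

lemma apply_Bcontfun_compact:
  fixes f :: "'a::topological_space \<Rightarrow> 'b::real_normed_vector"
  assumes "compact (UNIV :: 'a set)" "continuous_on UNIV f"
  shows "apply_bcontfun (Bcontfun f) = f"
  using assms by (intro Bcontfun_inverse) (auto simp: bcontfun_def intro: compact_imp_bounded compact_continuous_image)

text \<open>A continuous map from a compact space to a Hausdorff space is closed, hence a quotient map onto its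
  range.\<close>

lemma continuous_on_range_if_compose:
  fixes \<Phi> :: "'a::topological_space \<Rightarrow> 'b::t2_space" and h :: "'b \<Rightarrow> 'c::topological_space"
  assumes "compact (UNIV :: 'a set)" "continuous_on UNIV \<Phi>" "continuous_on UNIV (h \<circ> \<Phi>)"
  shows "continuous_on (range \<Phi>) h"
proof -
  have cl: "closed (\<Phi> ` K)" if "closed K" for K
    using that assms by (metis compact_Int_closed compact_continuous_image compact_imp_closed
        continuous_on_subset inf_top_left subset_UNIV)
  have "closed (h -` C \<inter> range \<Phi>)" if "closed C" for C
  proof -
    have "h -` C \<inter> range \<Phi> = \<Phi> ` ((h \<circ> \<Phi>) -` C)" by auto
    moreover have "closed ((h \<circ> \<Phi>) -` C)"
      using assms(3) that continuous_on_closed_vimage[of UNIV "h \<circ> \<Phi>"] by auto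
    ultimately show ?thesis using cl by simp
  qed
  moreover have "closed (range \<Phi>)" using cl[of UNIV] by simp
  ultimately show ?thesis by (simp add: continuous_on_closed_vimage)
qed

text \<open>A finite sum of squares: by compactness finitely many functions of \<open>A\<close> have no common zero.\<close>

lemma exists_positive_function:
  fixes A :: "('a::topological_space \<Rightarrow>\<^sub>C real) set"
  assumes comp: "compact (UNIV :: 'a set)"
    and zero: "0 \<in> A" and add: "\<And>f g. f \<in> A \<Longrightarrow> g \<in> A \<Longrightarrow> f + g \<in> A"
    and mult: "\<And>f g. f \<in> A \<Longrightarrow> g \<in> A \<Longrightarrow> bcf_mult f g \<in> A"
    and nowhere: "vanishes_nowhere A"
  obtains p where "p \<in> A" "\<And>x. apply_bcontfun p x > 0"
proof -
  have "open {x. apply_bcontfun f x \<noteq> 0}" for f :: "'a \<Rightarrow>\<^sub>C real"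
    by (intro open_Collect_neq continuous_on_const) auto
  moreover have "UNIV \<subseteq> (\<Union>f\<in>A. {x. apply_bcontfun f x \<noteq> 0})"
    using nowhere by (auto simp: vanishes_nowhere_def)
  ultimately obtain D where D: "D \<subseteq> A" "finite D" "UNIV \<subseteq> (\<Union>f\<in>D. {x. apply_bcontfun f x \<noteq> 0})"
    by (rule compactE_image[OF comp])
  have sum: "(\<Sum>f\<in>E. bcf_mult f f) \<in> A \<and>
      (\<forall>x. apply_bcontfun (\<Sum>f\<in>E. bcf_mult f f) x = (\<Sum>f\<in>E. (apply_bcontfun f x)\<^sup>2))"
    if "finite E" "E \<subseteq> A" for E
    using that
    by (induction E rule: finite_induct)
      (auto simp: zero add mult bcf_mult.rep_eq plus_bcontfun.rep_eq power2_eq_square)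
  have "0 < (\<Sum>f\<in>D. (apply_bcontfun f x)\<^sup>2)" for x
    proof -
    obtain f where "f \<in> D" "apply_bcontfun f x \<noteq> 0" using D(3) by blast
    then show ?thesis using D(2) by (intro sum_pos2[of D f]) auto
  qed
  with sum[OF D(2,1)] show thesis by (intro that[of "\<Sum>f\<in>D. bcf_mult f f"]) simp_all
qed

text \<open>The algebra \<open>A\<close> need not contain the constants that Stone--Weierstrass asks for. With a strictly
  positive \<open>p \<in> A\<close> this is avoided by approximating \<open>f / p\<close>, which is again constant on classes, by
  functions \<open>c + g\<close> with \<open>g \<in> A\<close>: multiplied by \<open>p\<close> they give \<open>c p + g p\<close>, an element of \<open>A\<close> close to
  \<open>f\<close>.\<close>

lemma closure_contains_class_functions_real:
  fixes A :: "('a::t2_space \<Rightarrow>\<^sub>C real) set"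
  assumes comp: "compact (UNIV :: 'a set)"
    and A_zero: "0 \<in> A" and A_add: "\<And>f g. f \<in> A \<Longrightarrow> g \<in> A \<Longrightarrow> f + g \<in> A"
    and A_scale: "\<And>c f. f \<in> A \<Longrightarrow> bcf_scale c f \<in> A"
    and A_mult: "\<And>f g. f \<in> A \<Longrightarrow> g \<in> A \<Longrightarrow> bcf_mult f g \<in> A"
    and nowhere: "vanishes_nowhere A"
    and f: "\<And>x y. (x, y) \<in> sim A \<Longrightarrow> apply_bcontfun f x = apply_bcontfun f y"
  shows "f \<in> closure A"
proof -
  obtain p where p: "p \<in> A" "\<And>x. apply_bcontfun p x > 0"
    using exists_positive_function[OF comp A_zero _ _ nowhere] A_add A_mult by blast
  define \<Phi> :: "'a \<Rightarrow> ('a \<Rightarrow>\<^sub>C real) \<Rightarrow> real"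
    where "\<Phi> x = (\<lambda>g. if g \<in> A then apply_bcontfun g x else 0)" for x
  have \<Phi>_cont: "continuous_on UNIV \<Phi>"
  proof (rule continuous_on_coordinatewise_then_product)
    fix g show "continuous_on UNIV (\<lambda>x. \<Phi> x g)"
      by (cases "g \<in> A") (auto simp: \<Phi>_def)
  qed
  \<comment> \<open>So the range of \<open>\<Phi>\<close> is a copy of the quotient of \<open>L\<close> by the relation.\<close>
  have \<Phi>_eq: "\<Phi> x = \<Phi> y \<longleftrightarrow> (x, y) \<in> sim A" for x y
    by (auto simp: \<Phi>_def sim_def fun_eq_iff)
  \<comment> \<open>Functions on the quotient that pull back to a constant plus an element of \<open>A\<close>.\<close>
  define R where "R = {h. \<exists>c. \<exists>g\<in>A. \<forall>x. h (\<Phi> x) = c + apply_bcontfun g x}"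
  interpret function_ring_on R "range \<Phi>"
  proof
    show "compact (range \<Phi>)" using comp \<Phi>_cont by (rule compact_continuous_image[rotated])
    show "continuous_on (range \<Phi>) h" if "h \<in> R" for h
    proof (rule continuous_on_range_if_compose[OF comp \<Phi>_cont])
      obtain c g where "g \<in> A" "\<And>x. h (\<Phi> x) = c + apply_bcontfun g x"
        using \<open>h \<in> R\<close> unfolding R_def by blast
      then show "continuous_on UNIV (h \<circ> \<Phi>)"
        by (auto simp: o_def intro!: continuous_intros)
    qed
    show "(\<lambda>_. c) \<in> R" for c
      unfolding R_def using A_zero by (auto intro!: exI[of _ c] bexI[of _ 0])
    show "(\<lambda>y. h y + k y) \<in> R" if "h \<in> R" "k \<in> R" for h k
    proof -
      obtain c g d l where "g \<in> A" "\<And>x. h (\<Phi> x) = c + apply_bcontfun g x"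
        "l \<in> A" "\<And>x. k (\<Phi> x) = d + apply_bcontfun l x"
        using \<open>h \<in> R\<close> \<open>k \<in> R\<close> unfolding R_def by blast
      then show ?thesis
        unfolding R_def using A_add[of g l]
        by (auto intro!: exI[of _ "c + d"] bexI[of _ "g + l"] simp: plus_bcontfun.rep_eq)
    qed
    show "(\<lambda>y. h y * k y) \<in> R" if "h \<in> R" "k \<in> R" for h k
    proof -
      obtain c g d l where *: "g \<in> A" "\<And>x. h (\<Phi> x) = c + apply_bcontfun g x"
        "l \<in> A" "\<And>x. k (\<Phi> x) = d + apply_bcontfun l x"
        using \<open>h \<in> R\<close> \<open>k \<in> R\<close> unfolding R_def by blast
      then have "bcf_scale c l + bcf_scale d g + bcf_mult g l \<in> A"
        by (intro A_add A_scale A_mult)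
      with * show ?thesis
        unfolding R_def
        by (auto intro!: exI[of _ "c * d"] bexI[of _ "bcf_scale c l + bcf_scale d g + bcf_mult g l"]
            simp: plus_bcontfun.rep_eq bcf_scale.rep_eq bcf_mult.rep_eq algebra_simps)
    qed
    show "\<exists>h\<in>R. h y \<noteq> h z" if y: "y \<in> range \<Phi>" and z: "z \<in> range \<Phi>" and neq: "y \<noteq> z" for y z
    proof -
      obtain g where g: "y g \<noteq> z g" using neq by auto
      then have "g \<in> A" using y z unfolding \<Phi>_def by (auto split: if_splits)
      then have "(\<lambda>y. y g) \<in> R"
        unfolding R_def by (auto simp: \<Phi>_def intro!: exI[of _ 0] bexI[of _ g])
      then show ?thesis using g by (intro bexI[of _ "\<lambda>y. y g"])
    qed
  qed
  define F where "F y = apply_bcontfun f (inv_into UNIV \<Phi> y) / apply_bcontfun p (inv_into UNIV \<Phi> y)" for y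
  have F: "F (\<Phi> x) = apply_bcontfun f x / apply_bcontfun p x" for x
  proof -
    have "\<Phi> (inv_into UNIV \<Phi> (\<Phi> x)) = \<Phi> x" by (simp add: f_inv_into_f)
    then have "(inv_into UNIV \<Phi> (\<Phi> x), x) \<in> sim A" by (simp only: \<Phi>_eq)
    then have "apply_bcontfun f (inv_into UNIV \<Phi> (\<Phi> x)) = apply_bcontfun f x"
      and "apply_bcontfun p (inv_into UNIV \<Phi> (\<Phi> x)) = apply_bcontfun p x"
      using p(1) f by (blast, simp add: sim_def)
    then show ?thesis by (simp add: F_def)
  qed
  have F_cont: "continuous_on (range \<Phi>) F"
    using p(2) by (intro continuous_on_range_if_compose[OF comp \<Phi>_cont])
      (auto simp: o_def F less_le intro!: continuous_intros)
  show ?thesis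
    unfolding closure_approachable
  proof (intro allI impI)
    fix e :: real assume "e > 0"
    \<comment> \<open>Multiplication by \<open>p\<close> enlarges errors by at most \<open>norm p\<close>; the summand \<open>1\<close> avoids division by zero.\<close>
    define d where "d = e / (2 * (norm p + 1))"
    have "d > 0" using \<open>e > 0\<close> by (auto simp: d_def intro!: divide_pos_pos add_nonneg_pos)
    then obtain h where h: "h \<in> R" "\<forall>y\<in>range \<Phi>. \<bar>F y - h y\<bar> < d"
      using Stone_Weierstrass_basic[OF F_cont] by blast
    then obtain c g where g: "g \<in> A" "\<And>x. h (\<Phi> x) = c + apply_bcontfun g x"
      unfolding R_def by blast
    let ?G = "bcf_scale c p + bcf_mult g p"
    have "dist ?G f \<le> (norm p + 1) * d"
    proof (rule dist_bound)
      fix x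
      have "\<bar>apply_bcontfun f x / apply_bcontfun p x - (c + apply_bcontfun g x)\<bar> \<le> d"
        using h(2) F g(2) by (auto intro: less_imp_le)
      moreover have "dist (apply_bcontfun ?G x) (apply_bcontfun f x) =
          apply_bcontfun p x * \<bar>apply_bcontfun f x / apply_bcontfun p x - (c + apply_bcontfun g x)\<bar>"
      proof -
        have "dist (apply_bcontfun ?G x) (apply_bcontfun f x) =
          \<bar>apply_bcontfun p x * (apply_bcontfun f x / apply_bcontfun p x - (c + apply_bcontfun g x))\<bar>"
          using p(2)[of x]
          by (simp add: dist_real_def plus_bcontfun.rep_eq bcf_scale.rep_eq bcf_mult.rep_eq
              abs_minus_commute algebra_simps)
        then show ?thesis using p(2)[of x] by (simp add: abs_mult)
      qed
      moreover have "apply_bcontfun p x \<le> norm p + 1"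
        using norm_bounded[of p x] by simp
      ultimately show "dist (apply_bcontfun ?G x) (apply_bcontfun f x) \<le> (norm p + 1) * d"
        using p(2)[of x] by (simp add: mult_mono)
    qed
    also have "\<dots> < e"
    proof -
      have "norm p + 1 > 0" by (simp add: add_nonneg_pos)
      then have "(norm p + 1) * d = e / 2" by (simp add: d_def field_simps)
      then show ?thesis using \<open>e > 0\<close> by simp
    qed
    finally show "\<exists>g\<in>A. dist g f < e"
      using A_add[OF A_scale[OF p(1)] A_mult[OF g(1) p(1)]] by blast
  qed
qed

text \<open>Self-adjointness puts the real and imaginary parts of the elements of \<open>A\<close> back into \<open>A\<close>. So the
  real-valued elements of \<open>A\<close> have the same classes as \<open>A\<close>, and the real case applies to the real and
  imaginary parts of \<open>f\<close> separately.\<close>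

lemma closure_contains_class_functions_complex:
  fixes A :: "('a::t2_space \<Rightarrow>\<^sub>C complex) set"
  assumes comp: "compact (UNIV :: 'a set)"
    and alg: "subalgebra A" and sa: "self_adjoint cnj A" and nowhere: "vanishes_nowhere A"
    and f: "\<And>x y. (x, y) \<in> sim A \<Longrightarrow> apply_bcontfun f x = apply_bcontfun f y"
  shows "f \<in> closure A"
proof -
  note A = subalgebraD[OF alg]
  define B where "B = {g :: 'a \<Rightarrow>\<^sub>C real. \<exists>h\<in>A. \<forall>x. apply_bcontfun h x = of_real (apply_bcontfun g x)}"
  define re where "re h = Bcontfun (\<lambda>x. Re (apply_bcontfun h x))" for h :: "'a \<Rightarrow>\<^sub>C complex"
  define im where "im h = Bcontfun (\<lambda>x. Im (apply_bcontfun h x))" for h :: "'a \<Rightarrow>\<^sub>C complex"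
  have re: "apply_bcontfun (re h) x = Re (apply_bcontfun h x)" for h x
    unfolding re_def by (subst apply_Bcontfun_compact[OF comp]) (auto intro!: continuous_intros)
  have im: "apply_bcontfun (im h) x = Im (apply_bcontfun h x)" for h x
    unfolding im_def by (subst apply_Bcontfun_compact[OF comp]) (auto intro!: continuous_intros)
  have reB: "re h \<in> B" and imB: "im h \<in> B" if h: "h \<in> A" for h
  proof -
    obtain k where k: "k \<in> A" "\<And>x. apply_bcontfun k x = cnj (apply_bcontfun h x)"
      using sa h unfolding self_adjoint_def by blast
    have "bcf_scale (1/2) (h + k) \<in> A" using A h k by blast
    moreover have "apply_bcontfun (bcf_scale (1/2) (h + k)) x = of_real (apply_bcontfun (re h) x)" for x
      by (simp add: bcf_scale.rep_eq plus_bcontfun.rep_eq k re complex_eq_iff)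
    ultimately show "re h \<in> B" unfolding B_def by blast
    have "bcf_scale (-\<i>/2) (h + bcf_scale (-1) k) \<in> A" using A h k by blast
    moreover have "apply_bcontfun (bcf_scale (-\<i>/2) (h + bcf_scale (-1) k)) x
        = of_real (apply_bcontfun (im h) x)" for x
      by (simp add: bcf_scale.rep_eq plus_bcontfun.rep_eq k im complex_eq_iff)
    ultimately show "im h \<in> B" unfolding B_def by blast
  qed
  have simB: "sim B \<subseteq> sim A"
  proof clarify
    fix x y assume xy: "(x, y) \<in> sim B"
    have "apply_bcontfun h x = apply_bcontfun h y" if "h \<in> A" for h
      using xy reB[OF that] imB[OF that] by (auto simp: sim_def complex_eq_iff re im)
    then show "(x, y) \<in> sim A" by (simp add: sim_def)
  qed
  have dense: "g \<in> closure B"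
    if "\<And>x y. (x, y) \<in> sim A \<Longrightarrow> apply_bcontfun g x = apply_bcontfun g y" for g
  proof (rule closure_contains_class_functions_real[OF comp])
    show "0 \<in> B" unfolding B_def using A(1) by (auto intro!: bexI[of _ 0])
    show "g + h \<in> B" if "g \<in> B" "h \<in> B" for g h
    proof -
      obtain g' h' where "g' \<in> A" "h' \<in> A" "\<forall>x. apply_bcontfun g' x = of_real (apply_bcontfun g x)"
        "\<forall>x. apply_bcontfun h' x = of_real (apply_bcontfun h x)" using \<open>g \<in> B\<close> \<open>h \<in> B\<close> unfolding B_def by blast
      then show ?thesis unfolding B_def using A(2)[of g' h']
        by (auto intro!: bexI[of _ "g' + h'"] simp: plus_bcontfun.rep_eq)
    qed
    show "bcf_mult g h \<in> B" if "g \<in> B" "h \<in> B" for g h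
    proof -
      obtain g' h' where "g' \<in> A" "h' \<in> A" "\<forall>x. apply_bcontfun g' x = of_real (apply_bcontfun g x)"
        "\<forall>x. apply_bcontfun h' x = of_real (apply_bcontfun h x)" using \<open>g \<in> B\<close> \<open>h \<in> B\<close> unfolding B_def by blast
      then show ?thesis unfolding B_def using A(4)[of g' h']
        by (auto intro!: bexI[of _ "bcf_mult g' h'"] simp: bcf_mult.rep_eq)
    qed
    show "bcf_scale c g \<in> B" if "g \<in> B" for c g
    proof -
      obtain g' where "g' \<in> A" "\<forall>x. apply_bcontfun g' x = of_real (apply_bcontfun g x)"
        using \<open>g \<in> B\<close> unfolding B_def by blast
      then show ?thesis unfolding B_def using A(3)[of g' "of_real c"]
        by (auto intro!: bexI[of _ "bcf_scale (of_real c) g'"] simp: bcf_scale.rep_eq)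
    qed
    show "vanishes_nowhere B"
      unfolding vanishes_nowhere_def
    proof
      fix x
      obtain h where "h \<in> A" "apply_bcontfun h x \<noteq> 0" using nowhere unfolding vanishes_nowhere_def by blast
      then show "\<exists>g\<in>B. apply_bcontfun g x \<noteq> 0"
        using reB[of h] imB[of h] by (metis re im complex_eq_iff zero_complex.simps)
    qed
    show "apply_bcontfun g x = apply_bcontfun g y" if "(x, y) \<in> sim B" for x y
      using that simB \<open>\<And>x y. (x, y) \<in> sim A \<Longrightarrow> apply_bcontfun g x = apply_bcontfun g y\<close> by blast
  qed
  have "re f \<in> closure B" "im f \<in> closure B"
    by (intro dense; simp add: re im f)+
  show ?thesis
    unfolding closure_approachable
  proof (intro allI impI)
    fix e :: real assume "e > 0"
    then have "e / 3 > 0" by simp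
    obtain u where u: "u \<in> B" "dist u (re f) < e / 3"
      using \<open>re f \<in> closure B\<close> \<open>e / 3 > 0\<close> unfolding closure_approachable by blast
    obtain v where v: "v \<in> B" "dist v (im f) < e / 3"
      using \<open>im f \<in> closure B\<close> \<open>e / 3 > 0\<close> unfolding closure_approachable by blast
    obtain h k where h: "h \<in> A" "\<And>x. apply_bcontfun h x = of_real (apply_bcontfun u x)"
      and k: "k \<in> A" "\<And>x. apply_bcontfun k x = of_real (apply_bcontfun v x)"
      using u v unfolding B_def by blast
    have "dist (h + bcf_scale \<i> k) f \<le> e / 3 + e / 3"
    proof (rule dist_bound)
      fix x
      have "dist (apply_bcontfun (h + bcf_scale \<i> k) x) (apply_bcontfun f x)
        \<le> \<bar>apply_bcontfun u x - Re (apply_bcontfun f x)\<bar> + \<bar>apply_bcontfun v x - Im (apply_bcontfun f x)\<bar>"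
        using cmod_le[of "apply_bcontfun (h + bcf_scale \<i> k) x - apply_bcontfun f x"]
        by (simp add: dist_norm plus_bcontfun.rep_eq bcf_scale.rep_eq h k)
      also have "\<dots> \<le> e / 3 + e / 3"
        using u(2) v(2) dist_bounded[of u x "re f"] dist_bounded[of v x "im f"]
        by (simp add: re im dist_real_def)
      finally show "dist (apply_bcontfun (h + bcf_scale \<i> k) x) (apply_bcontfun f x) \<le> e / 3 + e / 3" .
    qed
    also have "\<dots> < e" using \<open>e > 0\<close> by simp
    finally show "\<exists>g\<in>A. dist g f < e" using A(2)[OF h(1) A(3)[OF k(1)]] by blast
  qed
qed

section \<open>A continuum of independent power series\<close>

lemma (in vector_space) independent_family:
  assumes "\<And>D c. finite D \<Longrightarrow> D \<subseteq> J \<Longrightarrow> (\<Sum>t\<in>D. scale (c t) (v t)) = 0 \<Longrightarrow> \<forall>t\<in>D. c t = 0"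
  shows "inj_on v J" and "independent (v ` J)"
proof -
  show "inj_on v J"
  proof (rule inj_onI, rule ccontr)
    fix s t assume st: "s \<in> J" "t \<in> J" "v s = v t" "s \<noteq> t"
    let ?c = "\<lambda>u. if u = s then 1 else - 1"
    have "(\<Sum>u\<in>{s, t}. scale (?c u) (v u)) = 0" using st by simp
    with assms[of "{s, t}" ?c] st show False by auto
  qed
  show "independent (v ` J)"
    unfolding dependent_explicit
  proof clarify
    fix S u x assume S: "finite S" "S \<subseteq> v ` J" "(\<Sum>y\<in>S. scale (u y) y) = 0" "x \<in> S" "u x \<noteq> 0"
    obtain D where D: "D \<subseteq> J" "inj_on v D" "S = v ` D"
      using S(2) by (metis subset_image_inj)
    then have "finite D" "(\<Sum>t\<in>D. scale ((u \<circ> v) t) (v t)) = 0"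
      using S(1,3) by (auto simp: sum.reindex finite_image_iff)
    then have "\<forall>t\<in>D. (u \<circ> v) t = 0" using assms D(1) by blast
    then show False using S(4,5) D(3) by auto
  qed
qed

text \<open>The Vandermonde argument: by linearity \<open>\<Sum>u. c\<^sub>u p(s\<^sub>u) = 0\<close> for every polynomial \<open>p\<close>, in particular for
  one that vanishes at all nodes but \<open>s\<^sub>t\<close>.\<close>

lemma zero_coefficients_if_power_sums_zero:
  fixes c s :: "'i \<Rightarrow> 'k::field"
  assumes fin: "finite D" and inj: "inj_on s D"
    and zero: "\<And>n. (\<Sum>t\<in>D. c t * s t ^ n) = 0" and t: "t \<in> D"
  shows "c t = 0"
proof -
  have poly_zero: "(\<Sum>u\<in>D. c u * poly p (s u)) = 0" for p
  proof -
    have "(\<Sum>u\<in>D. c u * poly p (s u)) = (\<Sum>u\<in>D. \<Sum>i\<le>degree p. coeff p i * (c u * s u ^ i))"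
      by (simp add: poly_altdef sum_distrib_left mult_ac)
    also have "\<dots> = (\<Sum>i\<le>degree p. coeff p i * (\<Sum>u\<in>D. c u * s u ^ i))"
      by (subst sum.swap) (simp add: sum_distrib_left)
    finally show ?thesis by (simp add: zero)
  qed
  let ?p = "\<Prod>u\<in>D - {t}. [:- s u, 1:]"
  have "poly ?p (s u) = 0" if "u \<in> D - {t}" for u
    using that fin by (auto simp: poly_prod)
  then have "(\<Sum>u\<in>D. c u * poly ?p (s u)) = c t * poly ?p (s t)"
    using fin t by (subst sum.remove[of D t]) auto
  moreover have "poly ?p (s t) \<noteq> 0"
    using fin inj t by (auto simp: poly_prod inj_on_def)
  ultimately show ?thesis using poly_zero[of ?p] by simp
qed

lemma Urysohn_function_at_point:
  fixes a :: "'a::t2_space"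
  assumes comp: "compact (UNIV :: 'a set)" and F: "finite F" "a \<notin> F"
  obtains f :: "'a \<Rightarrow> real"
  where "continuous_on UNIV f" "\<And>x. f x \<in> {0..1}" "f a = 1" "\<And>x. x \<in> F \<Longrightarrow> f x = 0"
proof -
  have "Hausdorff_space (euclidean :: 'a topology)"
    unfolding Hausdorff_space_def disjnt_def open_openin[symmetric]
  proof clarify
    fix x y :: 'a assume "x \<noteq> y"
    then show "\<exists>U V. open U \<and> open V \<and> x \<in> U \<and> y \<in> V \<and> U \<inter> V = {}" by (rule hausdorff)
  qed
  then have "normal_space (euclidean :: 'a topology)"
    using comp by (intro compact_Hausdorff_or_regular_imp_normal_space) (simp_all add: compact_space_def)
  moreover have "closedin euclidean F" "closedin euclidean {a}" "disjnt F {a}"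
    using F by (auto simp: disjnt_def finite_imp_closed)
  ultimately obtain f where f: "continuous_map euclidean (top_of_set {0..1::real}) f"
    "f ` F \<subseteq> {0}" "f ` {a} \<subseteq> {1}"
    by (rule Urysohn_lemma[of _ F "{a}" 0 1]) auto
  show thesis
  proof
    show "continuous_on UNIV f" "\<And>x. f x \<in> {0..1}"
      using f(1) by (auto simp: continuous_map_in_subtopology)
  qed (use f in auto)
qed

text \<open>Each \<open>f m\<close> has to vanish at finitely many points only, all different from \<open>a m\<close>, so it exists even if
  the sequence \<open>a\<close> accumulates at its own terms or at points \<open>r (a n)\<close>. The price is that the matrix of the numbers
  \<open>f m (a n) - f m (r (a n))\<close> is triangular instead of diagonal.\<close>

lemma triangular_functions:
  fixes a r :: "_ \<Rightarrow> 'a::t2_space"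
  assumes comp: "compact (UNIV :: 'a set)" and inj: "inj a" and sep: "\<And>m n. a m \<noteq> r (a n)"
  obtains f :: "nat \<Rightarrow> 'a \<Rightarrow> real"
  where "\<And>m. continuous_on UNIV (f m)" "\<And>m x. f m x \<in> {0..1}"
    "\<And>m. f m (a m) - f m (r (a m)) = 1"
    "\<And>m n. n < m \<Longrightarrow> f m (a n) - f m (r (a n)) = 0"
proof -
  have "\<exists>f :: 'a \<Rightarrow> real. continuous_on UNIV f \<and> (\<forall>x. f x \<in> {0..1}) \<and> f (a m) - f (r (a m)) = 1 \<and>
      (\<forall>n<m. f (a n) - f (r (a n)) = 0)" for m
  proof -
    let ?F = "a ` {..<m} \<union> (\<lambda>n. r (a n)) ` {..m}"
    have "a m \<notin> ?F" using inj sep by (auto simp: inj_def)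
    then obtain f :: "'a \<Rightarrow> real" where f: "continuous_on UNIV f" "\<And>x. f x \<in> {0..1}" "f (a m) = 1"
      "\<And>x. x \<in> ?F \<Longrightarrow> f x = 0"
      using Urysohn_function_at_point[OF comp, of ?F "a m"] by auto
    have "f (r (a m)) = 0" "\<And>n. n < m \<Longrightarrow> f (a n) = 0" "\<And>n. n < m \<Longrightarrow> f (r (a n)) = 0"
      by (auto intro!: f(4))
    with f show ?thesis by (intro exI[of _ f]) simp
  qed
  then obtain f :: "nat \<Rightarrow> 'a \<Rightarrow> real" where "\<And>m. continuous_on UNIV (f m) \<and> (\<forall>x. f m x \<in> {0..1}) \<and>
      f m (a m) - f m (r (a m)) = 1 \<and> (\<forall>n<m. f m (a n) - f m (r (a n)) = 0)"
    by metis
  then show thesis by (intro that[of f]) simp_all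
qed

text \<open>The series converges uniformly by comparison with the geometric series.\<close>

lemma
  fixes f :: "nat \<Rightarrow> 'a::topological_space \<Rightarrow> real"
  assumes cont: "\<And>m. continuous_on UNIV (f m)" and bound: "\<And>m x. f m x \<in> {0..1}"
    and t: "0 < t" "t < 1"
  shows summable_power_series_of_functions: "summable (\<lambda>m. t ^ m * f m x)"
    and continuous_power_series_of_functions: "continuous_on UNIV (\<lambda>x. \<Sum>m. t ^ m * f m x)"
proof -
  have le: "norm (t ^ m * f m x) \<le> t ^ m" for m x
    using bound[of m x] t by (simp add: abs_mult mult_left_le)
  have geo: "summable (\<lambda>m. t ^ m)" using t by (intro summable_geometric) simp
  show "summable (\<lambda>m. t ^ m * f m x)"
    by (rule summable_comparison_test'[OF geo, of 0]) (rule le)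
  have "uniform_limit UNIV (\<lambda>n x. \<Sum>m<n. t ^ m * f m x) (\<lambda>x. \<Sum>m. t ^ m * f m x) sequentially"
    by (rule Weierstrass_m_test[OF le geo])
  then show "continuous_on UNIV (\<lambda>x. \<Sum>m. t ^ m * f m x)"
    by (rule uniform_limit_theorem[rotated])
      (auto intro!: always_eventually continuous_intros cont)
qed

section \<open>Counting functions\<close>

lemma Cinfinite_card_of:
  assumes "infinite X"
  shows "Cinfinite |X|"
  using assms card_of_Card_order[of X] by (simp add: cinfinite_def Field_card_of)

text \<open>\<open>(2 ^ \<aleph>\<^sub>0) ^ |N| = 2 ^ (\<aleph>\<^sub>0 * |N|) = 2 ^ |N|\<close>.\<close>

lemma continuum_cexp_le:
  assumes inf: "infinite N"
  shows "continuum ^c |N| \<le>o ctwo ^c |N|"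
proof -
  have "|Pow (UNIV :: nat set)| =o continuum"
    using nat_sets_eqpoll_reals by (simp add: eqpoll_iff_card_of_ordIso)
  then have "continuum =o |Pow (UNIV :: nat set)|" by (rule ordIso_symmetric)
  also have "|Pow (UNIV :: nat set)| =o ctwo ^c |UNIV :: nat set|"
    unfolding ctwo_def cexp_def Field_card_of by (rule card_of_Pow_Func)
  finally have "continuum ^c |N| =o (ctwo ^c |UNIV :: nat set| ) ^c |N|"
    by (rule cexp_cong1[OF _ card_of_Card_order])
  also have "(ctwo ^c |UNIV :: nat set| ) ^c |N| =o ctwo ^c ( |UNIV :: nat set| *c |N| )"
    by (rule cexp_cprod) (rule Card_order_ctwo)
  also have "ctwo ^c ( |UNIV :: nat set| *c |N| ) =o ctwo ^c |N|"
  proof (rule cexp_cong2[OF _ Card_order_ctwo Card_order_cprod])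
    have "|UNIV :: nat set| \<le>o |N|" using inf infinite_iff_card_of_nat by blast
    moreover have "Cnotzero |UNIV :: nat set|" "Cinfinite |N|"
      using Cinfinite_card_of[OF infinite_UNIV_nat] Cinfinite_card_of[OF inf] Cinfinite_Cnotzero
      by blast+
    ultimately show "|UNIV :: nat set| *c |N| =o |N|" by (intro cprod_infinite2')
  qed
  finally show ?thesis using ordIso_iff_ordLeq by blast
qed

section \<open>The defect map\<close>

abbreviation fun_scale :: "'k::field \<Rightarrow> ('a \<Rightarrow> 'k) \<Rightarrow> 'a \<Rightarrow> 'k" where
  "fun_scale c f \<equiv> (\<lambda>x. c * f x)"

lemma vector_space_fun_scale: "vector_space fun_scale"
  by unfold_locales (auto simp: fun_eq_iff algebra_simps)

lemma vector_space_bcf_scale: "vector_space bcf_scale"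
  by unfold_locales
    (auto simp: bcontfun_eqI plus_bcontfun.rep_eq bcf_scale.rep_eq algebra_simps intro!: bcontfun_eqI)

lemma linear_embedding_apply_bcontfun:
  "linear_embedding fun_scale
     (cfun_algebra :: ('k, 'a::topological_space \<Rightarrow>\<^sub>C 'k::real_normed_field) module) apply_bcontfun"
  unfolding linear_embedding_def linear_embedding_axioms_def
  by (auto simp: vector_space_fun_scale cfun_algebra_def inj_on_def
      plus_bcontfun.rep_eq zero_bcontfun.rep_eq bcf_scale.rep_eq fun_eq_iff intro: bcontfun_eqI)

lemmas vectorspace_cfun_algebra = linear_embedding.vectorspace[OF linear_embedding_apply_bcontfun]

text \<open>The map \<open>r\<close> sends each point to the representative of its class, so \<open>W\<close> is the space of continuous
  functions that are constant on classes, and the points moved by \<open>r\<close> are those outside the set of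
  representatives. The bound on the scalar field serves to count functions with values in it.\<close>

locale identification =
  fixes r :: "'a::t2_space \<Rightarrow> 'a" and W :: "('a \<Rightarrow>\<^sub>C 'k::real_normed_field) set"
  assumes compact: "compact (UNIV :: 'a set)"
    and retract: "r (r x) = r x"
    and infinite: "infinite {x. r x \<noteq> x}"
    and W_iff: "f \<in> W \<longleftrightarrow> (\<forall>x. apply_bcontfun f x = apply_bcontfun f (r x))"
    and card_field: "|UNIV :: 'k set| \<le>o continuum"
begin

text \<open>The linear map with kernel \<open>W\<close> through which the quotient by \<open>W\<close> is studied.\<close>

definition defect :: "('a \<Rightarrow>\<^sub>C 'k) \<Rightarrow> 'a \<Rightarrow> 'k" where
  "defect f = (\<lambda>x. apply_bcontfun f x - apply_bcontfun f (r x))"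

sublocale U: vector_space "fun_scale :: 'k \<Rightarrow> ('a \<Rightarrow> 'k) \<Rightarrow> 'a \<Rightarrow> 'k"
  by (rule vector_space_fun_scale)

sublocale C: vector_space "bcf_scale :: 'k \<Rightarrow> ('a \<Rightarrow>\<^sub>C 'k) \<Rightarrow> 'a \<Rightarrow>\<^sub>C 'k"
  by (rule vector_space_bcf_scale)

sublocale defect: Vector_Spaces.linear
  "bcf_scale :: 'k \<Rightarrow> ('a \<Rightarrow>\<^sub>C 'k) \<Rightarrow> 'a \<Rightarrow>\<^sub>C 'k" fun_scale defect
  by unfold_locales
    (auto simp: defect_def fun_eq_iff plus_bcontfun.rep_eq bcf_scale.rep_eq algebra_simps)

lemma defect_eq_0_iff: "defect f = 0 \<longleftrightarrow> f \<in> W"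
  by (auto simp: defect_def W_iff fun_eq_iff)

text \<open>Cosets are the fibres of the defect map, which turns computations with cosets into linearity.\<close>

lemma coset_eq: "W +>\<^bsub>cfun_algebra\<^esub> f = {g. defect g = defect f}"
proof -
  have "g \<in> W +>\<^bsub>cfun_algebra\<^esub> f \<longleftrightarrow> g - f \<in> W" for g
    unfolding a_r_coset_def' by (auto simp: cfun_algebra_def intro!: bexI[of _ "g - f"])
  moreover have "g - f \<in> W \<longleftrightarrow> defect g = defect f" for g
    by (simp add: defect_eq_0_iff[symmetric] defect.diff)
  ultimately show ?thesis by blast
qed

lemma coset_add:
  "(W +>\<^bsub>cfun_algebra\<^esub> f) <+>\<^bsub>cfun_algebra\<^esub> (W +>\<^bsub>cfun_algebra\<^esub> g) = W +>\<^bsub>cfun_algebra\<^esub> (f + g)"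
proof
  show "(W +>\<^bsub>cfun_algebra\<^esub> f) <+>\<^bsub>cfun_algebra\<^esub> (W +>\<^bsub>cfun_algebra\<^esub> g) \<subseteq> W +>\<^bsub>cfun_algebra\<^esub> (f + g)"
    unfolding coset_eq set_add_def' by (auto simp: cfun_algebra_def defect.add)
  show "W +>\<^bsub>cfun_algebra\<^esub> (f + g) \<subseteq> (W +>\<^bsub>cfun_algebra\<^esub> f) <+>\<^bsub>cfun_algebra\<^esub> (W +>\<^bsub>cfun_algebra\<^esub> g)"
  proof
    fix h assume "h \<in> W +>\<^bsub>cfun_algebra\<^esub> (f + g)"
    then have "defect (h - g) = defect f" by (simp add: coset_eq defect.add defect.diff)
    moreover have "h = (h - g) \<oplus>\<^bsub>cfun_algebra\<^esub> g" by (simp add: cfun_algebra_def)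
    ultimately show "h \<in> (W +>\<^bsub>cfun_algebra\<^esub> f) <+>\<^bsub>cfun_algebra\<^esub> (W +>\<^bsub>cfun_algebra\<^esub> g)"
      unfolding coset_eq set_add_def' by blast
  qed
qed

lemma coset_scale:
  "(\<Union>x\<in>W +>\<^bsub>cfun_algebra\<^esub> f. W +>\<^bsub>cfun_algebra\<^esub> (c \<odot>\<^bsub>cfun_algebra\<^esub> x)) = W +>\<^bsub>cfun_algebra\<^esub> (bcf_scale c f)"
  unfolding coset_eq by (auto simp: cfun_algebra_def defect.scale)

definition coset_defect :: "('a \<Rightarrow>\<^sub>C 'k) set \<Rightarrow> 'a \<Rightarrow> 'k" where
  "coset_defect K = defect (SOME f. f \<in> K)"

lemma coset_defect: "coset_defect (W +>\<^bsub>cfun_algebra\<^esub> f) = defect f"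
proof -
  have "(SOME g. g \<in> W +>\<^bsub>cfun_algebra\<^esub> f) \<in> W +>\<^bsub>cfun_algebra\<^esub> f"
    by (rule someI[of _ f]) (simp add: coset_eq)
  then show ?thesis by (simp add: coset_defect_def coset_eq)
qed

lemma carrier_quotient:
  "carrier (quotient_space cfun_algebra W) = range (\<lambda>f. W +>\<^bsub>cfun_algebra\<^esub> f)"
  unfolding quotient_space_def A_RCOSETS_def' by (auto simp: cfun_algebra_def)

lemma W_eq_coset: "W = W +>\<^bsub>cfun_algebra\<^esub> 0"
  unfolding coset_eq by (auto simp: defect.zero defect_eq_0_iff)

lemma linear_embedding_quotient:
  "linear_embedding fun_scale (quotient_space cfun_algebra W) coset_defect"
  unfolding linear_embedding_def linear_embedding_axioms_def carrier_quotient
proof (intro conjI allI impI vector_space_fun_scale)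
  show "inj_on coset_defect (range (\<lambda>f. W +>\<^bsub>cfun_algebra\<^esub> f))"
    by (auto simp: inj_on_def coset_defect) (auto simp: coset_eq)
  have z: "\<zero>\<^bsub>quotient_space cfun_algebra W\<^esub> = W +>\<^bsub>cfun_algebra\<^esub> 0"
    using W_eq_coset by (simp add: quotient_space_def)
  then show "\<zero>\<^bsub>quotient_space cfun_algebra W\<^esub> \<in> range (\<lambda>f. W +>\<^bsub>cfun_algebra\<^esub> f)" by simp
  show "coset_defect \<zero>\<^bsub>quotient_space cfun_algebra W\<^esub> = 0"
    unfolding z coset_defect by (rule defect.zero)
qed (auto simp: quotient_space_def coset_add coset_scale coset_defect defect.add defect.scale)

lemma coset_defect_image: "coset_defect ` carrier (quotient_space cfun_algebra W) = range defect"
  by (auto simp: carrier_quotient coset_defect image_image)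

lemma linear_embedding_subspace:
  assumes S: "subspace class_ring S cfun_algebra" and SW: "S \<subseteq> (UNIV - W) \<union> {0}"
  shows "linear_embedding fun_scale (cfun_algebra\<lparr>carrier := S\<rparr>) defect"
proof -
  have sub: "submodule class_ring S cfun_algebra" using S unfolding VectorSpace.subspace_def by blast
  have add: "f + g \<in> S" if "f \<in> S" "g \<in> S" for f g
    using submodule.m_closed[OF sub that] by (simp add: cfun_algebra_def)
  have scale: "bcf_scale c f \<in> S" if "f \<in> S" for c f
    using submodule.smult_closed[OF sub _ that, of c] by (simp add: cfun_algebra_def)
  have zero: "0 \<in> S" using submodule.zero_closed[OF sub] by (simp add: cfun_algebra_def)
  have "inj_on defect S"
  proof (rule inj_onI)
    fix f g assume fg: "f \<in> S" "g \<in> S" "defect f = defect g"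
    then have "f + bcf_scale (-1) g \<in> S" by (intro add scale)
    then have "f - g \<in> S" by simp
    moreover have "f - g \<in> W" using fg(3) by (simp add: defect_eq_0_iff[symmetric] defect.diff)
    ultimately show "f = g" using SW by auto
  qed
  then show ?thesis
    unfolding linear_embedding_def linear_embedding_axioms_def
    using add scale zero
    by (auto simp: vector_space_fun_scale cfun_algebra_def defect.zero defect.add defect.scale)
qed

text \<open>A defect vanishes at the points fixed by \<open>r\<close>, so it is determined by its values at the others.\<close>

lemma card_range_defect: "|range defect| \<le>o ctwo ^c |{x. r x \<noteq> x}|"
proof -
  let ?N = "{x. r x \<noteq> x}"
  let ?res = "\<lambda>u x. if x \<in> ?N then u x else undefined"
  have "inj_on ?res (range defect)"
  proof (rule inj_onI)
    fix u v assume uv: "u \<in> range defect" "v \<in> range defect" "?res u = ?res v"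
    have "u x = v x" for x
      using uv fun_cong[OF uv(3), of x] by (cases "r x = x") (auto simp: defect_def)
    then show "u = v" by blast
  qed
  moreover have "?res ` range defect \<subseteq> Func ?N UNIV" by (auto simp: Func_def)
  ultimately have "|range defect| \<le>o |Func ?N (UNIV :: 'k set)|"
    using card_of_ordLeq by blast
  also have "|Func ?N (UNIV :: 'k set)| = |UNIV :: 'k set| ^c |?N|"
    by (simp add: cexp_def Field_card_of)
  also have "|UNIV :: 'k set| ^c |?N| \<le>o continuum ^c |?N|"
    by (rule cexp_mono1[OF card_field card_of_Card_order])
  also have "continuum ^c |?N| \<le>o ctwo ^c |?N|" by (rule continuum_cexp_le[OF infinite])
  finally show ?thesis .
qed

text \<open>The functions are \<open>g s = (\<Sum>m. t\<^sup>m f\<^sub>m)\<close>, where \<open>f\<^sub>m\<close> is the triangular system for a sequence of points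
  moved by \<open>r\<close> and \<open>t\<close> runs through the unit interval. At the point \<open>a n\<close> the defect of \<open>g s\<close> is a
  polynomial of degree \<open>n\<close> in \<open>t\<close> with leading coefficient \<open>1\<close>, which is why a vanishing combination
  forces all power sums of its coefficients to vanish.\<close>

lemma independent_defects:
  obtains g :: "real \<Rightarrow> 'a \<Rightarrow>\<^sub>C 'k"
  where "inj (\<lambda>s. defect (g s))" "U.independent (range (\<lambda>s. defect (g s)))"
proof -
  obtain a :: "nat \<Rightarrow> 'a" where a: "inj a" "range a \<subseteq> {x. r x \<noteq> x}"
    using infinite_countable_subset[OF infinite] by blast
  have "a m \<noteq> r (a n)" for m n
  proof
    assume "a m = r (a n)"
    then have "r (a m) = a m" using retract[of "a n"] by simp
    then show False using a(2) by blast
  qed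
  then obtain f :: "nat \<Rightarrow> 'a \<Rightarrow> real" where f: "\<And>m. continuous_on UNIV (f m)" "\<And>m x. f m x \<in> {0..1}"
    "\<And>m. f m (a m) - f m (r (a m)) = 1" "\<And>m n. n < m \<Longrightarrow> f m (a n) - f m (r (a n)) = 0"
    using triangular_functions[OF compact a(1), of r] by blast
  \<comment> \<open>An injection of the real line into the open unit interval, where the power series converge.\<close>
  define \<tau> :: "real \<Rightarrow> real" where "\<tau> s = 1 / (1 + exp s)" for s
  have \<tau>: "0 < \<tau> s" "\<tau> s < 1" for s
    by (simp_all add: \<tau>_def add_pos_pos)
  have \<tau>_inj: "inj \<tau>"
    by (rule injI) (simp add: \<tau>_def)
  define G where "G s x = (\<Sum>m. \<tau> s ^ m * f m x)" for s x
  define g :: "real \<Rightarrow> 'a \<Rightarrow>\<^sub>C 'k" where "g s = Bcontfun (\<lambda>x. of_real (G s x))" for s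
  have g: "apply_bcontfun (g s) = (\<lambda>x. of_real (G s x))" for s
    unfolding g_def G_def
    using continuous_power_series_of_functions[OF f(1,2) \<tau>]
    by (intro apply_Bcontfun_compact[OF compact] continuous_on_of_real)
  have defect_g: "defect (g s) (a n)
      = (\<Sum>m\<le>n. of_real (f m (a n) - f m (r (a n))) * of_real (\<tau> s) ^ m)" for s n
  proof -
    note summ = summable_power_series_of_functions[OF f(1,2) \<tau>]
    have "G s (a n) - G s (r (a n)) = (\<Sum>m. \<tau> s ^ m * f m (a n) - \<tau> s ^ m * f m (r (a n)))"
      unfolding G_def by (rule suminf_diff[OF summ summ])
    also have "\<dots> = (\<Sum>m\<le>n. \<tau> s ^ m * f m (a n) - \<tau> s ^ m * f m (r (a n)))"
      using f(4) by (intro suminf_finite) (auto simp: not_le right_diff_distrib[symmetric])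
    finally have "G s (a n) - G s (r (a n)) = (\<Sum>m\<le>n. (f m (a n) - f m (r (a n))) * \<tau> s ^ m)"
      by (simp add: algebra_simps)
    then have "(of_real (G s (a n) - G s (r (a n))) :: 'k)
        = of_real (\<Sum>m\<le>n. (f m (a n) - f m (r (a n))) * \<tau> s ^ m)" by simp
    then show ?thesis by (simp add: defect_def g)
  qed
  have zero: "\<forall>s\<in>D. c s = 0"
    if D: "finite D" and sum: "(\<Sum>s\<in>D. fun_scale (c s) (defect (g s))) = 0" for D c
  proof
    fix s assume "s \<in> D"
    \<comment> \<open>The power sums, determined one after the other from the triangular system.\<close>
    define d where "d m = (\<Sum>s\<in>D. c s * of_real (\<tau> s) ^ m)" for m
    have tri: "(\<Sum>m\<le>n. of_real (f m (a n) - f m (r (a n))) * d m) = 0" for n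
    proof -
      have "(\<Sum>m\<le>n. of_real (f m (a n) - f m (r (a n))) * d m)
        = (\<Sum>s\<in>D. c s * defect (g s) (a n))"
        unfolding d_def defect_g sum_distrib_left
        by (subst sum.swap) (simp add: mult_ac)
      also have "\<dots> = (\<Sum>s\<in>D. fun_scale (c s) (defect (g s))) (a n)"
        using D by (induction D rule: finite_induct) auto
      finally show ?thesis by (simp add: sum)
    qed
    have "d n = 0" for n
    proof (induction n rule: less_induct)
      case (less n)
      have "(\<Sum>m\<le>n. of_real (f m (a n) - f m (r (a n))) * d m) = of_real (f n (a n) - f n (r (a n))) * d n"
        using less by (subst sum.remove[of _ n]) auto
      then show ?case using tri[of n] f(3)[of n] by simp
    qed
    then show "c s = 0"
      unfolding d_def using D \<tau>_inj \<open>s \<in> D\<close>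
      by (intro zero_coefficients_if_power_sums_zero[of D "\<lambda>s. of_real (\<tau> s)" c s])
        (auto simp: inj_on_def)
  qed
  show thesis
    using U.independent_family[of UNIV "\<lambda>s. defect (g s)"] zero by (intro that[of g]) blast+
qed

lemma card_range_real:
  assumes "inj (v :: real \<Rightarrow> 'b)"
  shows "|range v| =o continuum"
  using assms by (meson card_of_ordIsoI inj_on_imp_bij_betw ordIso_symmetric)

section \<open>Codimension and lineability\<close>

lemma continuum_le_codim: "continuum \<le>o codim class_ring cfun_algebra W"
proof -
  interpret Q: linear_embedding fun_scale "quotient_space cfun_algebra W" coset_defect
    by (rule linear_embedding_quotient)
  obtain g :: "real \<Rightarrow> 'a \<Rightarrow>\<^sub>C 'k"
    where g: "inj (\<lambda>s. defect (g s))" "U.independent (range (\<lambda>s. defect (g s)))"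
    by (rule independent_defects)
  have "|range (\<lambda>s. defect (g s))| \<le>o vdim class_ring (quotient_space cfun_algebra W)"
    using g by (intro Q.card_of_independent_le_vdim)
      (auto simp: coset_defect_image finite_image_iff infinite_UNIV_char_0)
  then show ?thesis
    unfolding codim_def using card_range_real[OF g(1)] ordIso_symmetric ordIso_ordLeq_trans by blast
qed

lemma codim_le: "codim class_ring cfun_algebra W \<le>o ctwo ^c |{x. r x \<noteq> x}|"
proof -
  interpret Q: linear_embedding fun_scale "quotient_space cfun_algebra W" coset_defect
    by (rule linear_embedding_quotient)
  show ?thesis
    unfolding codim_def
    using Q.vdim_le_card_of_carrier card_range_defect ordLeq_transitive
    unfolding coset_defect_image by blast
qed

text \<open>The span of the functions from \<open>independent_defects\<close>: independence of their defects makes the defect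
  map injective on it, so it meets \<open>W\<close> only in \<open>0\<close>.\<close>

lemma continuum_lineable: "lineable class_ring cfun_algebra continuum (UNIV - W)"
proof -
  obtain g :: "real \<Rightarrow> 'a \<Rightarrow>\<^sub>C 'k"
    where g: "inj (\<lambda>s. defect (g s))" "U.independent (range (\<lambda>s. defect (g s)))"
    by (rule independent_defects)
  define S where "S = C.span (range g)"
  have img: "defect ` range g = range (\<lambda>s. defect (g s))" by (simp add: image_image)
  have inj: "inj_on defect S"
    unfolding S_def using g
    by (intro defect.inj_on_span_independent_image) (auto simp: img inj_on_def)
  have sub: "subspace class_ring S cfun_algebra"
    unfolding VectorSpace.subspace_def submodule_def
    using vectorspace_cfun_algebra
    by (auto simp: cfun_algebra_def S_def vectorspace_def intro: C.span_add C.span_scale C.span_zero)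
  have SW: "S \<subseteq> (UNIV - W) \<union> {0}"
  proof
    fix f assume "f \<in> S"
    moreover have "0 \<in> S" by (simp add: S_def C.span_zero)
    ultimately show "f \<in> (UNIV - W) \<union> {0}"
      using inj_onD[OF inj, of f 0] defect_eq_0_iff[of f] defect.zero by auto
  qed
  interpret S: linear_embedding fun_scale "cfun_algebra\<lparr>carrier := S\<rparr>" defect
    by (rule linear_embedding_subspace[OF sub SW])
  have "vdim class_ring (cfun_algebra\<lparr>carrier := S\<rparr>) =o |range (\<lambda>s. defect (g s))|"
    using g by (intro S.vdim_eq_card_of_independent_spanning)
      (auto simp: S_def defect.span_image[symmetric] img finite_image_iff infinite_UNIV_char_0)
  then have "vdim class_ring (cfun_algebra\<lparr>carrier := S\<rparr>) =o continuum"
    using card_range_real[OF g(1)] ordIso_transitive by blast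
  then show ?thesis
    unfolding lineable_def using sub SW by (intro exI[of _ S]) (simp add: cfun_algebra_def)
qed

text \<open>A subspace that meets \<open>W\<close> only in \<open>0\<close> embeds into the range of the defect map and so has at most as
  many elements.\<close>

lemma not_lineable:
  "\<not> lineable class_ring cfun_algebra (cardSuc (ctwo ^c |{x. r x \<noteq> x}| )) (UNIV - W)"
proof
  let ?k = "ctwo ^c |{x. r x \<noteq> x}|"
  assume "lineable class_ring cfun_algebra (cardSuc ?k) (UNIV - W)"
  then obtain S where S: "subspace class_ring S cfun_algebra" "S \<subseteq> (UNIV - W) \<union> {0}"
    and vdim: "vdim class_ring (cfun_algebra\<lparr>carrier := S\<rparr>) =o cardSuc ?k"
    unfolding lineable_def by (auto simp: cfun_algebra_def)
  interpret S: linear_embedding fun_scale "cfun_algebra\<lparr>carrier := S\<rparr>" defect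
    by (rule linear_embedding_subspace[OF S])
  have "vdim class_ring (cfun_algebra\<lparr>carrier := S\<rparr>) \<le>o |defect ` S|"
    using S.vdim_le_card_of_carrier by simp
  also have "|defect ` S| \<le>o |range defect|" by (intro card_of_mono1) auto
  also have "|range defect| \<le>o ?k" by (rule card_range_defect)
  also have "?k <o cardSuc ?k" by (rule cardSuc_greater[OF Card_order_cexp])
  finally show False using vdim not_ordLess_ordIso by blast
qed

end

section \<open>Passage to the equivalence relation\<close>

lemma equiv_sim: "equiv UNIV (sim A)"
  by (auto simp: sim_def equiv_def refl_on_def sym_def trans_def)

lemma exists_set_of_representatives:
  assumes "equiv UNIV \<rho>"
  shows "\<exists>R. set_of_representatives \<rho> R"
proof
  let ?rep = "\<lambda>C. SOME x. x \<in> C"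
  have rep: "?rep C \<in> C" if "C \<in> UNIV // \<rho>" for C
    using in_quotient_imp_non_empty[OF assms that] by (simp add: some_in_eq)
  show "set_of_representatives \<rho> (?rep ` (UNIV // \<rho>))"
    unfolding set_of_representatives_def
  proof
    fix C assume C: "C \<in> UNIV // \<rho>"
    show "\<exists>!x. x \<in> ?rep ` (UNIV // \<rho>) \<inter> C"
    proof (rule ex1I[of _ "?rep C"])
      show "?rep C \<in> ?rep ` (UNIV // \<rho>) \<inter> C" using rep C by blast
      fix x assume "x \<in> ?rep ` (UNIV // \<rho>) \<inter> C"
      then obtain C' where C': "C' \<in> UNIV // \<rho>" "x = ?rep C'" "x \<in> C" by blast
      then have "C' = C" using quotient_disj[OF assms C'(1) C] rep[OF C'(1)] by blast
      then show "x = ?rep C" using C'(2) by simp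
    qed
  qed
qed

lemma retraction_onto_representatives:
  assumes eq: "equiv UNIV \<rho>" and R: "set_of_representatives \<rho> R"
  obtains r where "\<And>x. r (r x) = r x" "\<And>x y. (x, y) \<in> \<rho> \<longleftrightarrow> r x = r y"
    "UNIV - R = {x. r x \<noteq> x}"
proof -
  define r where "r x = (THE y. y \<in> R \<inter> \<rho> `` {x})" for x
  have uniq: "\<exists>!y. y \<in> R \<inter> \<rho> `` {x}" for x
  proof -
    have "\<rho> `` {x} \<in> UNIV // \<rho>" by (rule quotientI) simp
    with R[unfolded set_of_representatives_def] show ?thesis by (rule bspec)
  qed
  have r: "r x \<in> R \<inter> \<rho> `` {x}" for x
    unfolding r_def by (rule theI'[OF uniq])
  have r_eq: "r x = y" if "y \<in> R" "(x, y) \<in> \<rho>" for x y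
    unfolding r_def using that by (intro the1_equality[OF uniq]) auto
  have refl: "(x, x) \<in> \<rho>" for x using eq by (auto simp: equiv_def refl_on_def)
  show thesis
  proof
    show "r (r x) = r x" for x using r[of x] refl by (intro r_eq) auto
    show "(x, y) \<in> \<rho> \<longleftrightarrow> r x = r y" for x y
    proof
      assume "(x, y) \<in> \<rho>"
      then show "r x = r y" unfolding r_def using equiv_class_eq[OF eq] by simp
    next
      assume "r x = r y"
      then have "(x, r y) \<in> \<rho>" "(y, r y) \<in> \<rho>" using r[of x] r[of y] by auto
      then show "(x, y) \<in> \<rho>" using eq by (meson equiv_def symE transE)
    qed
    have "r x = x \<longleftrightarrow> x \<in> R" for x using r[of x] r_eq[OF _ refl, of x] by auto
    then show "UNIV - R = {x. r x \<noteq> x}" by blast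
  qed
qed

lemma closure_respects_sim:
  fixes A :: "('a::topological_space \<Rightarrow>\<^sub>C 'k::real_normed_field) set"
  assumes f: "f \<in> closure A" and xy: "(x, y) \<in> sim A"
  shows "apply_bcontfun f x = apply_bcontfun f y"
proof (rule ccontr)
  assume neq: "apply_bcontfun f x \<noteq> apply_bcontfun f y"
  define e where "e = dist (apply_bcontfun f x) (apply_bcontfun f y) / 2"
  have "e > 0" using neq by (simp add: e_def)
  then obtain g where g: "g \<in> A" "dist g f < e" using f unfolding closure_approachable by blast
  have "apply_bcontfun g x = apply_bcontfun g y" using g(1) xy by (auto simp: sim_def)
  then have "dist (apply_bcontfun f x) (apply_bcontfun f y)
    \<le> dist (apply_bcontfun g x) (apply_bcontfun f x) + dist (apply_bcontfun g y) (apply_bcontfun f y)"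
    by (metis dist_commute dist_triangle)
  also have "\<dots> < 2 * e" using dist_bounded[of g x f] dist_bounded[of g y f] g(2) by simp
  finally show False by (simp add: e_def)
qed

text \<open>The real and the complex case differ only in the Stone--Weierstrass theorem, which enters through the
  assumption \<open>dense\<close>, and in the cardinality of the scalar field. The inclusion opposite to \<open>dense\<close> holds
  because evaluation at a point is continuous.\<close>

lemma codim_and_lineability_of_class_functions:
  fixes A :: "('a::t2_space \<Rightarrow>\<^sub>C 'k::real_normed_field) set"
  assumes comp: "compact (UNIV :: 'a set)" and card: "|UNIV :: 'k set| \<le>o continuum"
    and inf: "cinfinite (equiv_order (sim A))"
    and dense: "\<And>f. (\<And>x y. (x, y) \<in> sim A \<Longrightarrow> apply_bcontfun f x = apply_bcontfun f y) \<Longrightarrow> f \<in> closure A"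
  shows "continuum \<le>o codim class_ring cfun_algebra (closure A) \<and>
    codim class_ring cfun_algebra (closure A) \<le>o ctwo ^c equiv_order (sim A) \<and>
    lineable class_ring cfun_algebra continuum (UNIV - closure A) \<and>
    \<not> lineable class_ring cfun_algebra (cardSuc (ctwo ^c equiv_order (sim A))) (UNIV - closure A)"
proof -
  have "set_of_representatives (sim A) (SOME R. set_of_representatives (sim A) R)"
    using exists_set_of_representatives[OF equiv_sim] by (rule someI_ex)
  then obtain r :: "'a \<Rightarrow> 'a" where r: "\<And>x. r (r x) = r x" "\<And>x y. (x, y) \<in> sim A \<longleftrightarrow> r x = r y"
    "UNIV - (SOME R. set_of_representatives (sim A) R) = {x. r x \<noteq> x}"
    using retraction_onto_representatives[OF equiv_sim] by blast
  have order: "equiv_order (sim A) = |{x. r x \<noteq> x}|"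
    unfolding equiv_order_def r(3) ..
  interpret identification r "closure A"
  proof
    show "infinite {x. r x \<noteq> x}" using inf by (simp add: order cinfinite_def Field_card_of)
    show "f \<in> closure A \<longleftrightarrow> (\<forall>x. apply_bcontfun f x = apply_bcontfun f (r x))" for f
    proof
      assume f: "f \<in> closure A"
      have "(x, r x) \<in> sim A" for x by (simp add: r)
      then show "\<forall>x. apply_bcontfun f x = apply_bcontfun f (r x)"
        using closure_respects_sim[OF f] by blast
    next
      assume f: "\<forall>x. apply_bcontfun f x = apply_bcontfun f (r x)"
      show "f \<in> closure A"
      proof (rule dense)
        fix x y assume "(x, y) \<in> sim A"
        then have "apply_bcontfun f (r x) = apply_bcontfun f (r y)" by (simp only: r(2))
        then show "apply_bcontfun f x = apply_bcontfun f y"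
          using spec[OF f, of x] spec[OF f, of y] by (simp only:)
      qed
    qed
  qed (use comp r(1) card in auto)
  show ?thesis
    unfolding order using continuum_le_codim codim_le continuum_lineable not_lineable by blast
qed

lemma card_complex_le_continuum: "|UNIV :: complex set| \<le>o continuum"
proof -
  have "|UNIV :: complex set| \<le>o |UNIV \<times> UNIV :: (real \<times> real) set|"
    by (intro card_of_ordLeqI[of "\<lambda>z. (Re z, Im z)"]) (auto simp: inj_on_def complex_eq_iff)
  also have "|UNIV \<times> UNIV :: (real \<times> real) set| =o continuum"
    by (rule card_of_Times_same_infinite) (simp add: infinite_UNIV_char_0)
  finally show ?thesis .
qed

theorem proposition3p4:
  assumes "compact (UNIV :: 'a::t2_space set)"
  shows
    "(\<forall>A :: ('a \<Rightarrow>\<^sub>C real) set.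
        subalgebra A \<and> self_adjoint (\<lambda>z. z) A \<and> vanishes_nowhere A \<and> cinfinite (equiv_order (sim A)) \<longrightarrow>
        continuum \<le>o codim class_ring cfun_algebra (closure A) \<and>
        codim class_ring cfun_algebra (closure A) \<le>o ctwo ^c equiv_order (sim A) \<and>
        lineable class_ring cfun_algebra continuum (UNIV - closure A) \<and>
        \<not> lineable class_ring cfun_algebra (cardSuc (ctwo ^c equiv_order (sim A))) (UNIV - closure A)) \<and>
     (\<forall>A :: ('a \<Rightarrow>\<^sub>C complex) set.
        subalgebra A \<and> self_adjoint cnj A \<and> vanishes_nowhere A \<and> cinfinite (equiv_order (sim A)) \<longrightarrow>
        continuum \<le>o codim class_ring cfun_algebra (closure A) \<and>
        codim class_ring cfun_algebra (closure A) \<le>o ctwo ^c equiv_order (sim A) \<and>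
        lineable class_ring cfun_algebra continuum (UNIV - closure A) \<and>
        \<not> lineable class_ring cfun_algebra (cardSuc (ctwo ^c equiv_order (sim A))) (UNIV - closure A))"
proof (rule conjI; intro allI impI; elim conjE)
  fix A :: "('a \<Rightarrow>\<^sub>C real) set"
  assume A: "subalgebra A" "vanishes_nowhere A" "cinfinite (equiv_order (sim A))"
  show "continuum \<le>o codim class_ring cfun_algebra (closure A) \<and>
        codim class_ring cfun_algebra (closure A) \<le>o ctwo ^c equiv_order (sim A) \<and>
        lineable class_ring cfun_algebra continuum (UNIV - closure A) \<and>
        \<not> lineable class_ring cfun_algebra (cardSuc (ctwo ^c equiv_order (sim A))) (UNIV - closure A)"
  proof (rule codim_and_lineability_of_class_functions[OF assms _ A(3)])
    show "|UNIV :: real set| \<le>o continuum" by (rule ordLeq_refl[OF card_of_Card_order])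
    show "f \<in> closure A" if "\<And>x y. (x, y) \<in> sim A \<Longrightarrow> apply_bcontfun f x = apply_bcontfun f y" for f
      by (rule closure_contains_class_functions_real[OF assms subalgebraD[OF A(1)] A(2) that])
  qed
next
  fix A :: "('a \<Rightarrow>\<^sub>C complex) set"
  assume A: "subalgebra A" "self_adjoint cnj A" "vanishes_nowhere A" "cinfinite (equiv_order (sim A))"
  show "continuum \<le>o codim class_ring cfun_algebra (closure A) \<and>
        codim class_ring cfun_algebra (closure A) \<le>o ctwo ^c equiv_order (sim A) \<and>
        lineable class_ring cfun_algebra continuum (UNIV - closure A) \<and>
        \<not> lineable class_ring cfun_algebra (cardSuc (ctwo ^c equiv_order (sim A))) (UNIV - closure A)"
  proof (rule codim_and_lineability_of_class_functions[OF assms _ A(4)])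
    show "|UNIV :: complex set| \<le>o continuum" by (rule card_complex_le_continuum)
    show "f \<in> closure A" if "\<And>x y. (x, y) \<in> sim A \<Longrightarrow> apply_bcontfun f x = apply_bcontfun f y" for f
      by (rule closure_contains_class_functions_complex[OF assms A(1,2,3) that])
  qed
qed

end
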